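(* Let $N\ge 1$, let $\mathcal X\in\mathbb R^{I_1\times\cdots\times I_N}$ be a fixed tensor and $\mathbf b\in\mathbb R^{I_{N+1}}$ a fixed vector. Let $\mathcal G\in\mathbb R^{R_1\times\cdots\times R_{N+1}}$ and $\mathbf U^{(n)}\in\mathbb R^{I_n\times R_n}$ for $n=1,\dots,N+1$, and set $$\mathcal W=\mathcal G\times_1\mathbf U^{(1)}\times_2\cdots\times_{N+1}\mathbf U^{(N+1)}\in\mathbb R^{I_1\times\cdots\times I_{N+1}},\qquad F(\mathcal X)=\mathcal W_{(N+1)}\,\mathrm{vec}(\mathcal X)+\mathbf b\in\mathbb R^{I_{N+1}}.$$ Let $L$ be a scalar loss that is a differentiable function of the output $F(\mathcal X)$, and write $\frac{\partial L}{\partial F(\mathcal X)}\in\mathbb R^{I_{N+1}}$ for its gradient (a column vector). For each $n\in\{1,\dots,N+1\}$ let $\mathbf P_n$ be the permutation matrix of size $I_1\cdots I_{N+1}$ satisfying $\mathrm{vec}(\mathcal T_{(N+1)})=\mathbf P_n\,\mathrm{vec}(\mathcal T_{(n)})$ for all $\mathcal T\in\mathbb R^{I_1\times\cdots\times I_{N+1}}$. Then the gradients of $L$ with respect to the factor matrices and to the core tensor (each regarded as a function of the indicated variable with all others held fixed) are, for every $n\in\{1,\dots,N+1\}$, $$\frac{\partial L}{\partial\,\mathrm{vec}(\mathbf U^{(n)})}=\Big(\mathbf P_n\big[(\mathbf U^{(N+1)}\otimes\cdots\otimes\mathbf U^{(n+1)}\otimes\mathbf U^{(n-1)}\otimes\cdots\otimes\mathbf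 U^{(1)})\,\mathcal G_{(n)}^T\otimes\mathbf I_{I_n}\big]\Big)^T\big(\mathrm{vec}(\mathcal X)^T\otimes\mathbf I_{I_{N+1}}\big)^T\frac{\partial L}{\partial F(\mathcal X)}\in\mathbb R^{R_nI_n},$$ and $$\frac{\partial L}{\partial\,\mathrm{vec}(\mathcal G_{(N+1)})}=\big((\mathbf U^{(N)}\otimes\cdots\otimes\mathbf U^{(1)})\otimes\mathbf U^{(N+1)}\big)^T\big(\mathrm{vec}(\mathcal X)^T\otimes\mathbf I_{I_{N+1}}\big)^T\frac{\partial L}{\partial F(\mathcal X)}\in\mathbb R^{R_1\cdots R_{N+1}}.$$
   Context: Little-endian convention: multi-indices are linearized as $\overline{i_1i_2\cdots i_K}=i_1+(i_2-1)I_1+(i_3-1)I_1I_2+\cdots$ (first index varies fastest). For a tensor $\mathcal T\in\mathbb R^{I_1\times\cdots\times I_K}$, $\mathrm{vec}(\mathcal T)\in\mathbb R^{I_1\cdots I_K}$ has entry $t_{i_1\cdots i_K}$ at position $\overline{i_1\cdots i_K}$ (for matrices: column stacking). The mode-$n$ unfolding $\mathcal T_{(n)}\in\mathbb R^{I_n\times I_1\cdots I_{n-1}I_{n+1}\cdots I_K}$ has entries $(\mathcal T_{(n)})_{i_n,\overline{i_1\cdots i_{n-1}i_{n+1}\cdots i_K}}=t_{i_1\cdots i_K}$. The mode-$n$ product of $\mathcal G\in\mathbb R^{R_1\times\cdots\times R_K}$ with a matrix $\mathbf U\in\mathbb R^{I_n\times R_n}$ replaces the $n$-th mode: $(\mathcal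 G\times_n\mathbf U)_{r_1\cdots r_{n-1}\,i_n\,r_{n+1}\cdots r_K}=\sum_{r_n}g_{r_1\cdots r_K}u_{i_nr_n}$. $\otimes$ is the Kronecker product: for $\mathbf A\in\mathbb R^{M\times N}$, $\mathbf B\in\mathbb R^{P\times Q}$, $(\mathbf A\otimes\mathbf B)_{P(r-1)+v,\,Q(s-1)+w}=a_{rs}b_{vw}$. In the expression in square brackets, $\mathbf K\,\mathcal G_{(n)}^T\otimes\mathbf I_{I_n}$ means $(\mathbf K\mathcal G_{(n)}^T)\otimes\mathbf I_{I_n}$. $\mathbf I_M$ is the $M\times M$ identity matrix. *)

theory Defs
  imports
    "HOL-Analysis.Analysis"
    "HOL-Combinatorics.Permutations"
    "Jordan_Normal_Form.Matrix"
begin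

text \<open>
  Modes, multi-indices and linear positions are 0-based throughout: an order-\<open>K\<close> tensor has the
  modes \<open>0, \<dots>, K - 1\<close>, and a multi-index is a list of naturals, one per mode, with
  the entry for mode \<open>k\<close> below the \<open>k\<close>-th dimension.
\<close>

section \<open>Multi-indices\<close>

text \<open>Little-endian linearisation (the first index varies fastest) and its inverse.\<close>

fun lin :: "nat list \<Rightarrow> nat list \<Rightarrow> nat" where
  "lin (d # ds) (i # is) = i + d * lin ds is"
| "lin _ _ = 0"

fun delin :: "nat list \<Rightarrow> nat \<Rightarrow> nat list" where
  "delin [] k = []"
| "delin (d # ds) k = (k mod d) # delin ds (k div d)"

definition valid_index :: "nat list \<Rightarrow> nat list \<Rightarrow> bool" where
  "valid_index ds is \<longleftrightarrow> list_all2 (<) is ds"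

lemma lin_less: "valid_index ds is \<Longrightarrow> lin ds is < prod_list ds"
  unfolding valid_index_def
proof (induction "is" ds rule: list_all2_induct)
  case (Cons i "is" d ds)
  have "i + d * lin ds is < d + d * lin ds is" using Cons by simp
  also have "\<dots> = d * Suc (lin ds is)" by simp
  also have "\<dots> \<le> d * prod_list ds" using Cons by (intro mult_le_mono) auto
  finally show ?case by simp
qed simp

lemma delin_lin: "valid_index ds is \<Longrightarrow> delin ds (lin ds is) = is"
  unfolding valid_index_def by (induction "is" ds rule: list_all2_induct) auto

lemma valid_delin: "k < prod_list ds \<Longrightarrow> valid_index ds (delin ds k)"
  unfolding valid_index_def
  by (induction ds k rule: delin.induct)
     (auto simp: less_mult_imp_div_less mult.commute intro!: mod_less_divisor gr0I)

lemma lin_delin: "k < prod_list ds \<Longrightarrow> lin ds (delin ds k) = k"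
  by (induction ds k rule: delin.induct) (auto simp: less_mult_imp_div_less mult.commute)

definition remove_nth :: "nat \<Rightarrow> 'a list \<Rightarrow> 'a list" where
  "remove_nth n xs = take n xs @ drop (Suc n) xs"

definition insert_nth :: "nat \<Rightarrow> 'a \<Rightarrow> 'a list \<Rightarrow> 'a list" where
  "insert_nth n x xs = take n xs @ x # drop n xs"

lemma insert_remove_nth: "n < length xs \<Longrightarrow> insert_nth n (xs ! n) (remove_nth n xs) = xs"
  by (simp add: insert_nth_def remove_nth_def id_take_nth_drop [symmetric])

lemma remove_insert_nth: "n \<le> length xs \<Longrightarrow> remove_nth n (insert_nth n x xs) = xs"
  by (simp add: insert_nth_def remove_nth_def)

section \<open>Tensors\<close>

text \<open>Only the entries at valid multi-indices are meaningful.\<close>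

datatype 'a tensor = Tensor (dims: "nat list") (entry: "nat list \<Rightarrow> 'a")

definition vec_tensor :: "'a tensor \<Rightarrow> 'a vec" where
  "vec_tensor T = vec (prod_list (dims T)) (\<lambda>k. entry T (delin (dims T) k))"

lemma vec_tensor_lin:
  "valid_index (dims T) is \<Longrightarrow> vec_tensor T $ lin (dims T) is = entry T is"
  by (simp add: vec_tensor_def lin_less delin_lin)

definition mode_unfold :: "nat \<Rightarrow> 'a tensor \<Rightarrow> 'a mat" where
  "mode_unfold n T =
     mat (dims T ! n) (prod_list (remove_nth n (dims T)))
       (\<lambda>(i, j). entry T (insert_nth n i (delin (remove_nth n (dims T)) j)))"

lemma valid_remove_nth:
  "valid_index ds is \<Longrightarrow> valid_index (remove_nth n ds) (remove_nth n is)"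
  unfolding valid_index_def remove_nth_def
  by (intro list_all2_appendI) (auto intro: list_all2_takeI list_all2_dropI)

lemma mode_unfold_lin:
  assumes "valid_index (dims T) is" "n < length (dims T)"
  shows "mode_unfold n T $$ (is ! n, lin (remove_nth n (dims T)) (remove_nth n is)) = entry T is"
proof -
  have "is ! n < dims T ! n" "length is = length (dims T)"
    using assms by (auto simp: valid_index_def list_all2_conv_all_nth)
  then show ?thesis
    using assms(2) valid_remove_nth [OF assms(1), of n]
    by (simp add: mode_unfold_def lin_less delin_lin insert_remove_nth)
qed

text \<open>The tensor with dimensions \<open>ds\<close> whose mode-\<open>n\<close> unfolding is \<open>A\<close>.\<close>

definition mode_refold :: "nat list \<Rightarrow> nat \<Rightarrow> 'a mat \<Rightarrow> 'a tensor" where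
  "mode_refold ds n A =
     Tensor ds (\<lambda>is. A $$ (is ! n, lin (remove_nth n ds) (remove_nth n is)))"

definition mode_prod :: "'a::comm_semiring_1 tensor \<Rightarrow> nat \<Rightarrow> 'a mat \<Rightarrow> 'a tensor" where
  "mode_prod G n U =
     Tensor ((dims G)[n := dim_row U])
       (\<lambda>is. \<Sum>r<dim_col U. entry G (is[n := r]) * U $$ (is ! n, r))"

section \<open>Matrices\<close>

text \<open>Column stacking, i.e. \<open>vec_tensor\<close> of the matrix seen as an order-2 tensor.\<close>

definition vec_mat :: "'a mat \<Rightarrow> 'a vec" where
  "vec_mat A = vec (dim_row A * dim_col A) (\<lambda>k. A $$ (k mod dim_row A, k div dim_row A))"

lemma vec_mat_eq_vec_tensor:
  "vec_mat A = vec_tensor (Tensor [dim_row A, dim_col A] (\<lambda>is. A $$ (is ! 0, is ! 1)))"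
  by (rule eq_vecI)
     (auto simp: vec_mat_def vec_tensor_def less_mult_imp_div_less mult.commute)

definition unvec_mat :: "nat \<Rightarrow> nat \<Rightarrow> 'a vec \<Rightarrow> 'a mat" where
  "unvec_mat nr nc u = mat nr nc (\<lambda>(i, j). u $ (i + nr * j))"

lemma index_less_mult: "i < (a::nat) \<Longrightarrow> j < b \<Longrightarrow> i + a * j < a * b"
  using lin_less [of "[a, b]" "[i, j]"] by (simp add: valid_index_def)

lemma unvec_vec_mat: "unvec_mat (dim_row A) (dim_col A) (vec_mat A) = A"
  by (rule eq_matI) (auto simp: unvec_mat_def vec_mat_def index_less_mult)

lemma vec_unvec_mat:
  assumes "u \<in> carrier_vec (nr * nc)"
  shows "vec_mat (unvec_mat nr nc u) = u"
proof (rule eq_vecI)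
  fix k assume "k < dim_vec u"
  then have k: "k < nr * nc" using assms by simp
  then have "nr > 0" by (auto intro: gr0I)
  moreover have "k div nr < nc" using k by (simp add: less_mult_imp_div_less mult.commute)
  ultimately show "vec_mat (unvec_mat nr nc u) $ k = u $ k"
    using k by (simp add: unvec_mat_def vec_mat_def)
qed (use assms in \<open>simp add: unvec_mat_def vec_mat_def\<close>)

lemma mode_unfold_refold:
  assumes "n < length ds" "A \<in> carrier_mat (ds ! n) (prod_list (remove_nth n ds))"
  shows "mode_unfold n (mode_refold ds n A) = A"
proof (rule eq_matI)
  fix i j assume ij: "i < dim_row A" "j < dim_col A"
  let ?is = "delin (remove_nth n ds) j"
  have "length ?is = length (remove_nth n ds)"
    using valid_delin [of j "remove_nth n ds"] ij assms
    by (auto simp: valid_index_def dest: list_all2_lengthD)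
  then have "n \<le> length ?is" using assms by (simp add: remove_nth_def)
  then show "mode_unfold n (mode_refold ds n A) $$ (i, j) = A $$ (i, j)"
    using ij assms
    by (auto simp: mode_unfold_def mode_refold_def remove_insert_nth lin_delin)
       (simp add: insert_nth_def nth_append)
qed (use assms in \<open>auto simp: mode_unfold_def mode_refold_def\<close>)

text \<open>0-based form of \<open>(A \<otimes> B)\<^bsub>P(r-1)+v, Q(s-1)+w\<^esub> = a\<^bsub>rs\<^esub> b\<^bsub>vw\<^esub>\<close>.\<close>

definition kron :: "'a::semiring_1 mat \<Rightarrow> 'a mat \<Rightarrow> 'a mat" where
  "kron A B =
     mat (dim_row A * dim_row B) (dim_col A * dim_col B)
       (\<lambda>(i, j). A $$ (i div dim_row B, j div dim_col B) * B $$ (i mod dim_row B, j mod dim_col B))"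

definition kron_list :: "'a::semiring_1 mat list \<Rightarrow> 'a mat" where
  "kron_list As = foldr kron As (1\<^sub>m 1)"

definition permutation_matrix :: "nat \<Rightarrow> 'a::semiring_1 mat \<Rightarrow> bool" where
  "permutation_matrix m P \<longleftrightarrow>
     (\<exists>p. p permutes {..<m} \<and> P = mat m m (\<lambda>(i, j). if j = p i then 1 else 0))"

section \<open>Gradients\<close>

text \<open>
  The vectors of the matrix library carry no topology, so Frechet differentiability on
  \<open>\<real>\<^sup>m\<close> (that is, \<open>carrier_vec m\<close>) with respect to the Euclidean norm is spelled out:
  \<open>f (x + h) = f x + g \<bullet> h + o(\<parallel>h\<parallel>)\<close>.
\<close>

definition euclid_norm :: "real vec \<Rightarrow> real" where
  "euclid_norm h = sqrt (h \<bullet> h)"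

definition has_gradient :: "nat \<Rightarrow> (real vec \<Rightarrow> real) \<Rightarrow> real vec \<Rightarrow> real vec \<Rightarrow> bool" where
  "has_gradient m f x g \<longleftrightarrow>
     x \<in> carrier_vec m \<and> g \<in> carrier_vec m \<and>
     (\<forall>e>0. \<exists>d>0. \<forall>h\<in>carrier_vec m. euclid_norm h < d \<longrightarrow>
        \<bar>f (x + h) - f x - g \<bullet> h\<bar> \<le> e * euclid_norm h)"

definition gradient :: "nat \<Rightarrow> (real vec \<Rightarrow> real) \<Rightarrow> real vec \<Rightarrow> real vec" where
  "gradient m f x = (THE g. has_gradient m f x g)"

lemma has_gradient_unique:
  assumes g: "has_gradient m f x g" and g': "has_gradient m f x g'"
  shows "g = g'"
proof (rule ccontr)
  assume ne: "g \<noteq> g'"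
  have c: "g \<in> carrier_vec m" "g' \<in> carrier_vec m"
    using g g' by (auto simp: has_gradient_def)
  define v where "v = g - g'"
  have v: "v \<in> carrier_vec m" using c by (simp add: v_def)
  define s where "s = euclid_norm v"
  have nn: "v \<bullet> v \<ge> 0" by (auto simp: scalar_prod_def intro: sum_nonneg)
  have "v \<bullet> v \<noteq> 0"
  proof
    assume "v \<bullet> v = 0"
    then have "\<forall>i\<in>{0..<m}. v $ i * v $ i = 0"
      using v by (subst (asm) scalar_prod_def, subst (asm) sum_nonneg_eq_0_iff) auto
    then have "g = g'" using c by (intro eq_vecI) (auto simp: v_def)
    with ne show False ..
  qed
  with nn have s: "s > 0" and ss: "v \<bullet> v = s * s" by (auto simp: s_def euclid_norm_def)
  from s have "s / 4 > 0" by simp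
  with g obtain d where d: "d > 0" and
    D: "\<And>h. h \<in> carrier_vec m \<Longrightarrow> euclid_norm h < d \<Longrightarrow>
          \<bar>f (x + h) - f x - g \<bullet> h\<bar> \<le> s / 4 * euclid_norm h"
    unfolding has_gradient_def by blast
  from \<open>s / 4 > 0\<close> g' obtain d' where d': "d' > 0" and
    D': "\<And>h. h \<in> carrier_vec m \<Longrightarrow> euclid_norm h < d' \<Longrightarrow>
          \<bar>f (x + h) - f x - g' \<bullet> h\<bar> \<le> s / 4 * euclid_norm h"
    unfolding has_gradient_def by blast
  define t where "t = min d d' / (2 * s)"
  have t: "t > 0" using d d' s by (simp add: t_def)
  define h where "h = t \<cdot>\<^sub>v v"
  have h: "h \<in> carrier_vec m" using v by (simp add: h_def)
  have "h \<bullet> h = (t * s) * (t * s)"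
    using v ss by (simp add: h_def algebra_simps)
  then have nh: "euclid_norm h = t * s" using t s by (simp add: euclid_norm_def)
  have "t * s = min d d' / 2" using s by (simp add: t_def)
  then have "euclid_norm h < d" "euclid_norm h < d'" using nh d d' by auto
  from D [OF h this(1)] D' [OF h this(2)]
  have "\<bar>g \<bullet> h - g' \<bullet> h\<bar> \<le> s / 2 * (t * s)" by (simp add: nh abs_if split: if_splits)
  moreover have "g \<bullet> h - g' \<bullet> h = v \<bullet> h"
    using c h by (simp add: v_def minus_scalar_prod_distrib)
  moreover have "v \<bullet> h = s * (t * s)" using v ss by (simp add: h_def algebra_simps)
  ultimately show False using s t by (simp add: abs_if split: if_splits)
qed

lemma gradient_eqI: "has_gradient m f x g \<Longrightarrow> gradient m f x = g"
  unfolding gradient_def using has_gradient_unique by blast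

section \<open>The Tucker-structured affine layer\<close>

text \<open>\<open>tucker K G U\<close> is \<open>G\<close> multiplied in each mode \<open>n < K\<close> by \<open>U n\<close>, mode 0 first.\<close>

definition tucker :: "nat \<Rightarrow> 'a::comm_semiring_1 tensor \<Rightarrow> (nat \<Rightarrow> 'a mat) \<Rightarrow> 'a tensor" where
  "tucker K G U = fold (\<lambda>n T. mode_prod T n (U n)) [0..<K] G"

text \<open>Input modes \<open>0, \<dots>, N - 1\<close>, output mode \<open>N\<close>.\<close>

definition layer ::
  "nat \<Rightarrow> real tensor \<Rightarrow> real vec \<Rightarrow> real tensor \<Rightarrow> (nat \<Rightarrow> real mat) \<Rightarrow> real vec" where
  "layer N X b G U = mode_unfold N (tucker (Suc N) G U) *\<^sub>v vec_tensor X + b"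

end

theory Submission
  imports Defs
begin

text \<open>
  The identity \<open>vec (A X B) = (B\<^sup>T \<otimes> A) vec X\<close> is used three times: with \<open>W\<^sub>(\<^sub>n\<^sub>) = U\<^sub>n G\<^sub>(\<^sub>n\<^sub>) K\<^sup>T\<close>
  (\<open>K\<close> the Kronecker product of the other factors) it makes \<open>vec W\<^sub>(\<^sub>n\<^sub>)\<close> linear in \<open>vec U\<^sub>n\<close> and
  \<open>vec W\<^sub>(\<^sub>N\<^sub>)\<close> linear in \<open>vec G\<^sub>(\<^sub>N\<^sub>)\<close>, and with \<open>W\<^sub>(\<^sub>N\<^sub>) vec X\<close> it makes the output affine in
  \<open>vec W\<^sub>(\<^sub>N\<^sub>)\<close>. Each gradient is then that of \<open>L\<close> composed with an affine map \<open>u \<mapsto> M u + c\<close>,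
  namely \<open>M\<^sup>T \<nabla>L\<close>.
\<close>

section \<open>Sums over multi-indices\<close>

lemma valid_index_length: "valid_index ds is \<Longrightarrow> length is = length ds"
  by (simp add: valid_index_def list_all2_lengthD)

lemma valid_index_append1_iff:
  "valid_index (ds @ [d]) is \<longleftrightarrow> (\<exists>js i. is = js @ [i] \<and> valid_index ds js \<and> i < d)"
proof
  show "valid_index (ds @ [d]) is \<Longrightarrow> \<exists>js i. is = js @ [i] \<and> valid_index ds js \<and> i < d"
    by (auto simp: valid_index_def list_all2_append2 list_all2_Cons2)
qed (auto simp: valid_index_def intro: list_all2_appendI)

text \<open>\<open>lin\<close> and \<open>delin\<close> are mutually inverse on the valid ranges.
  This later turns a sum over multi-indices into a sum over the columns of an unfolding.\<close>

lemma bij_betw_lin: "bij_betw (lin ds) {is. valid_index ds is} {..<prod_list ds}"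
  by (rule bij_betw_byWitness [where f' = "delin ds"])
     (auto simp: delin_lin lin_delin lin_less valid_delin)

text \<open>Peels off the last mode, the one that the induction on the number of mode products
  adds.\<close>

lemma sum_valid_index_append1:
  "(\<Sum>is | valid_index (ds @ [d]) is. f is) = (\<Sum>i<d. \<Sum>is | valid_index ds is. f (is @ [i]))"
proof -
  have "(\<Sum>is | valid_index (ds @ [d]) is. f is) =
      (\<Sum>(i, is)\<in>{..<d} \<times> {is. valid_index ds is}. f (is @ [i]))"
    by (rule sum.reindex_bij_witness [where i = "\<lambda>(i, is). is @ [i]" and j = "\<lambda>is. (last is, butlast is)"])
       (auto simp: valid_index_append1_iff)
  then show ?thesis by (simp add: sum.cartesian_product)
qed

section \<open>Removing and inserting a single mode\<close>

lemma remove_nth_map: "remove_nth n (map f xs) = map f (remove_nth n xs)"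
  by (simp add: remove_nth_def take_map drop_map)

lemma remove_nth_upt: "n < k \<Longrightarrow> remove_nth n [0..<k] = [0..<n] @ [Suc n..<k]"
  by (simp add: remove_nth_def)

lemma valid_insert_nth:
  assumes "n < length ds" "i < ds ! n" "valid_index (remove_nth n ds) is"
  shows "valid_index ds (insert_nth n i is)"
proof -
  have "list_all2 (<) is (take n ds @ drop (Suc n) ds)"
    using assms by (simp add: valid_index_def remove_nth_def)
  \<comment> \<open>The list is cut where the removed dimension stood: \<open>js\<close> has length
    \<open>n\<close>, so \<open>i\<close> is inserted exactly between \<open>js\<close> and
    \<open>ks\<close>.\<close>
  then obtain js ks where js: "is = js @ ks" "list_all2 (<) js (take n ds)" "list_all2 (<) ks (drop (Suc n) ds)"
    by (auto simp: list_all2_append2)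
  then have "length js = n" using assms(1) by (auto dest: list_all2_lengthD)
  then have "insert_nth n i is = js @ i # ks" by (simp add: js insert_nth_def)
  moreover have "ds = take n ds @ ds ! n # drop (Suc n) ds"
    using assms(1) by (simp add: id_take_nth_drop)
  ultimately show ?thesis
    using js assms unfolding valid_index_def
    by (metis list_all2_Cons list_all2_appendI)
qed

text \<open>Separates the index of mode \<open>n\<close>, which the factor \<open>U n\<close>
  contracts, from the indices of the other modes, which the Kronecker product contracts.\<close>

lemma sum_valid_index_insert_nth:
  assumes "n < length ds"
  shows "(\<Sum>is | valid_index ds is. f is) =
    (\<Sum>i<ds ! n. \<Sum>is | valid_index (remove_nth n ds) is. f (insert_nth n i is))"
proof -
  have "(\<Sum>is | valid_index ds is. f is) =
      (\<Sum>(i, is)\<in>{..<ds ! n} \<times> {is. valid_index (remove_nth n ds) is}. f (insert_nth n i is))"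
  proof (rule sum.reindex_bij_witness
      [where i = "\<lambda>(i, is). insert_nth n i is" and j = "\<lambda>is. (is ! n, remove_nth n is)"])
    fix p assume p: "p \<in> {..<ds ! n} \<times> {is. valid_index (remove_nth n ds) is}"
    then have "n \<le> length (snd p)"
      using assms by (auto simp: remove_nth_def dest: valid_index_length)
    then show "((case p of (i, is) \<Rightarrow> insert_nth n i is) ! n,
        remove_nth n (case p of (i, is) \<Rightarrow> insert_nth n i is)) = p"
      by (auto simp: remove_insert_nth split: prod.splits) (simp add: insert_nth_def nth_append)
  qed (use assms in \<open>auto simp: valid_insert_nth valid_remove_nth insert_remove_nth
         dest: valid_index_length, auto simp: valid_index_def list_all2_conv_all_nth\<close>)
  then show ?thesis by (simp add: sum.cartesian_product)
qed

section \<open>Dimension products and mixed-radix digits\<close>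

lemma prod_list_remove_nth:
  "n < length ds \<Longrightarrow> prod_list (remove_nth n ds) * ds ! n = prod_list (ds :: nat list)"
  by (subst (3) id_take_nth_drop [of n ds]) (simp_all add: remove_nth_def)

lemma delin_append: "delin (ds @ es) k = delin ds k @ delin es (k div prod_list ds)"
  by (induction ds k rule: delin.induct) (auto simp: div_mult2_eq)

text \<open>In mixed radix \<open>ds\<close>, a multiple of \<open>prod_list ds\<close> affects only
  digits beyond those that \<open>delin ds\<close> reads.\<close>

lemma delin_mod_prod_list: "delin ds (k mod prod_list ds) = delin ds k"
proof (induction ds k rule: delin.induct)
  case (2 d ds k)
  have "k mod (d * prod_list ds) = k mod d + d * ((k div d) mod prod_list ds)"
    by (metis mod_mult2_eq add.commute)
  \<comment> \<open>For \<open>d = 0\<close> the modulus is 0, and \<open>k mod 0 = k\<close> makes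
    both sides equal.\<close>
  then show ?case using 2 by (cases "d = 0") auto
qed simp

section \<open>Kronecker products\<close>

lemma kron_carrier:
  "A \<in> carrier_mat m n \<Longrightarrow> B \<in> carrier_mat p q \<Longrightarrow> kron A B \<in> carrier_mat (m * p) (n * q)"
  by (auto simp: kron_def)

lemma kron_index:
  "i < dim_row A * dim_row B \<Longrightarrow> j < dim_col A * dim_col B \<Longrightarrow>
    kron A B $$ (i, j) = A $$ (i div dim_row B, j div dim_col B) * B $$ (i mod dim_row B, j mod dim_col B)"
  by (simp add: kron_def)

lemma sum_lessThan_mult:
  "(\<Sum>k<m * n. f k) = (\<Sum>j<n. \<Sum>i<m. f (i + m * j :: nat))"
proof -
  have *: "k mod m < m \<and> k div m < n" if "k < m * n" for k
    using that by (cases "m = 0") (auto simp: less_mult_imp_div_less mult.commute)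
  have "(\<Sum>k<m * n. f k) = (\<Sum>(j, i)\<in>{..<n} \<times> {..<m}. f (i + m * j))"
    by (rule sum.reindex_bij_witness [where i = "\<lambda>(j, i). i + m * j" and j = "\<lambda>k. (k div m, k mod m)"])
       (use * in \<open>auto simp: index_less_mult\<close>)
  then show ?thesis by (simp add: sum.cartesian_product)
qed

text \<open>Position \<open>k\<close> of the stacked product is row \<open>k mod m\<close>, column
  \<open>k div m\<close>. The row index \<open>k\<close> of the Kronecker product splits in the same
  way between \<open>A\<close> and the transpose of \<open>B\<close>, and its column index
  \<open>r + p * s\<close> splits into \<open>r\<close> for \<open>A\<close> and \<open>s\<close>
  for the transpose of \<open>B\<close>, so both sides are the same double sum.\<close>

lemma vec_mat_mult_kron:
  fixes A :: "'a::comm_semiring_1 mat"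
  assumes "A \<in> carrier_mat m p" "X \<in> carrier_mat p q" "B \<in> carrier_mat q n"
  shows "vec_mat (A * X * B) = kron B\<^sup>T A *\<^sub>v vec_mat X"
proof (rule eq_vecI)
  fix k assume "k < dim_vec (kron B\<^sup>T A *\<^sub>v vec_mat X)"
  then have k: "k < n * m" using assms by (simp add: kron_def)
  then have ij: "k mod m < m" "k div m < n"
    by (auto simp: less_mult_imp_div_less intro!: mod_less_divisor gr0I)
  have "(kron B\<^sup>T A *\<^sub>v vec_mat X) $ k =
      (\<Sum>l<p * q. kron B\<^sup>T A $$ (k, l) * vec_mat X $ l)"
    using assms k by (auto simp: scalar_prod_def kron_def vec_mat_def lessThan_atLeast0 mult.commute intro!: sum.cong)
  also have "\<dots> = (\<Sum>s<q. \<Sum>r<p. kron B\<^sup>T A $$ (k, r + p * s) * vec_mat X $ (r + p * s))"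
    by (rule sum_lessThan_mult)
  also have "\<dots> = (\<Sum>s<q. \<Sum>r<p. A $$ (k mod m, r) * X $$ (r, s) * B $$ (s, k div m))"
  proof (intro sum.cong refl)
    fix s r assume sr: "s \<in> {..<q}" "r \<in> {..<p}"
    then have "r + p * s < p * q" by (simp add: index_less_mult)
    then show "kron B\<^sup>T A $$ (k, r + p * s) * vec_mat X $ (r + p * s) =
        A $$ (k mod m, r) * X $$ (r, s) * B $$ (s, k div m)"
      using assms sr k ij by (auto simp: kron_index vec_mat_def mult_ac)
  qed
  also have "\<dots> = (\<Sum>r<p. \<Sum>s<q. A $$ (k mod m, r) * (X $$ (r, s) * B $$ (s, k div m)))"
    by (subst sum.swap) (simp add: mult.assoc)
  also have "\<dots> = vec_mat (A * X * B) $ k"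
    using assms k ij
    by (simp add: vec_mat_def scalar_prod_def sum_distrib_left lessThan_atLeast0 mult.commute [of n])
  finally show "vec_mat (A * X * B) $ k = (kron B\<^sup>T A *\<^sub>v vec_mat X) $ k" ..
qed (use assms in \<open>simp add: vec_mat_def kron_def\<close>)

text \<open>The case of the previous identity with the identity matrix on the left and, on the
  right, \<open>x\<close> as a one-column matrix.\<close>

lemma mult_mat_vec_eq_kron:
  fixes A :: "'a::comm_semiring_1 mat"
  assumes "A \<in> carrier_mat m n" "x \<in> carrier_vec n"
  shows "A *\<^sub>v x = kron (mat_of_row x) (1\<^sub>m m) *\<^sub>v vec_mat A"
proof -
  have "A *\<^sub>v x = vec_mat (A * (mat_of_row x)\<^sup>T)"
    using assms by (intro eq_vecI) (auto simp: vec_mat_def scalar_prod_def)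
  also have "\<dots> = vec_mat (1\<^sub>m m * A * (mat_of_row x)\<^sup>T)"
    using assms by simp
  also have "\<dots> = kron (mat_of_row x)\<^sup>T\<^sup>T (1\<^sub>m m) *\<^sub>v vec_mat A"
    using assms by (intro vec_mat_mult_kron) auto
  finally show ?thesis by simp
qed

text \<open>The product over all modes of single matrix entries. It is the coefficient common to
  iterated mode products and iterated Kronecker products, and so links the two.\<close>

definition entry_prod :: "'a::comm_semiring_1 mat list \<Rightarrow> nat list \<Rightarrow> nat list \<Rightarrow> 'a" where
  "entry_prod As is js = prod_list (map2 ($$) As (zip is js))"

lemma entry_prod_append:
  "length is = length As \<Longrightarrow> length js = length As \<Longrightarrow>
    entry_prod (As @ Bs) (is @ is') (js @ js') = entry_prod As is js * entry_prod Bs is' js'"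
  by (simp add: entry_prod_def)

text \<open>By commutativity the factor of mode \<open>n\<close> moves to the front, which isolates
  \<open>U n\<close> from the other factor matrices.\<close>

lemma entry_prod_remove_nth:
  assumes "n < length As" "length is = length As" "length js = length As"
  shows "entry_prod As is js = As ! n $$ (is ! n, js ! n) *
    entry_prod (remove_nth n As) (remove_nth n is) (remove_nth n js)"
proof -
  have "entry_prod As is js = entry_prod (take n As @ As ! n # drop (Suc n) As)
      (take n is @ is ! n # drop (Suc n) is) (take n js @ js ! n # drop (Suc n) js)"
    using assms by (simp add: id_take_nth_drop [symmetric])
  also have "\<dots> = entry_prod (take n As) (take n is) (take n js) *
      entry_prod (As ! n # drop (Suc n) As) (is ! n # drop (Suc n) is) (js ! n # drop (Suc n) js)"
    using assms by (intro entry_prod_append) auto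
  also have "\<dots> = As ! n $$ (is ! n, js ! n) * (entry_prod (take n As) (take n is) (take n js) *
      entry_prod (drop (Suc n) As) (drop (Suc n) is) (drop (Suc n) js))"
    by (simp add: entry_prod_def mult_ac)
  finally show ?thesis
    using assms by (simp add: remove_nth_def entry_prod_append)
qed

lemma kron_list_Cons: "kron_list (A # As) = kron A (kron_list As)"
  by (simp add: kron_list_def)

lemma dim_kron_list [simp]:
  "dim_row (kron_list As) = prod_list (map dim_row As)"
  "dim_col (kron_list As) = prod_list (map dim_col As)"
  by (induction As) (auto simp: kron_list_def kron_def)

lemma prod_list_map_rev: "prod_list (map f (rev xs)) = prod_list (map (f :: _ \<Rightarrow> nat) xs)"
  by (simp add: rev_map [symmetric] prod_list.rev)

text \<open>The right factor of \<open>kron\<close> has the fastest varying index, whereas in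
  \<open>lin\<close> the first index varies fastest; reversing the list reconciles the two. In the
  induction the last matrix of \<open>As\<close> becomes the leftmost Kronecker factor, addressed by
  the quotients, and the remainders address the others.\<close>

lemma kron_list_rev_index:
  assumes "i < prod_list (map dim_row As)" "j < prod_list (map dim_col As)"
  shows "kron_list (rev As) $$ (i, j) =
    entry_prod As (delin (map dim_row As) i) (delin (map dim_col As) j)"
  using assms
proof (induction As arbitrary: i j rule: rev_induct)
  case Nil
  then show ?case by (simp add: kron_list_def entry_prod_def)
next
  case (snoc A As)
  let ?m = "prod_list (map dim_row As)" and ?n = "prod_list (map dim_col As)"
  have len: "length (delin ds k) = length ds" for ds k
    by (induction ds k rule: delin.induct) auto
  \<comment> \<open>Positive moduli put the remainders \<open>i mod ?m\<close> and
    \<open>j mod ?n\<close> in range for the induction hypothesis.\<close>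
  have pos: "?m > 0" "?n > 0" using snoc.prems by (auto intro!: gr0I)
  have lt: "i div ?m < dim_row A" "j div ?n < dim_col A"
    using snoc.prems by (auto simp: less_mult_imp_div_less mult.commute)
  have "kron_list (rev (As @ [A])) $$ (i, j) =
      A $$ (i div ?m, j div ?n) * kron_list (rev As) $$ (i mod ?m, j mod ?n)"
    using snoc.prems by (simp add: kron_list_Cons kron_index prod_list_map_rev mult.commute)
  also have "kron_list (rev As) $$ (i mod ?m, j mod ?n) =
      entry_prod As (delin (map dim_row As) i) (delin (map dim_col As) j)"
    using snoc.IH pos by (simp add: delin_mod_prod_list)
  also have "A $$ (i div ?m, j div ?n) = entry_prod [A] [i div ?m] [j div ?n]"
    by (simp add: entry_prod_def)
  finally show ?case
    using lt by (simp add: delin_append entry_prod_append len mult.commute)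
qed

section \<open>Unfolding the Tucker tensor\<close>

lemma tucker_Suc: "tucker (Suc K) G U = mode_prod (tucker K G U) K (U K)"
  by (simp add: tucker_def)

lemma dims_tucker:
  "K \<le> length (dims G) \<Longrightarrow> dims (tucker K G U) = map (\<lambda>n. dim_row (U n)) [0..<K] @ drop K (dims G)"
proof (induction K)
  case 0
  then show ?case by (simp add: tucker_def)
next
  case (Suc K)
  then show ?case
    by (simp add: tucker_Suc mode_prod_def list_update_append Cons_nth_drop_Suc [symmetric])
qed

text \<open>After \<open>K\<close> mode products the first \<open>K\<close> indices have been
  contracted with the factors, while the remaining ones still address \<open>G\<close>
  directly.\<close>

lemma entry_tucker:
  assumes "K \<le> length is"
  shows "entry (tucker K G U) is =
    (\<Sum>rs | valid_index (map (\<lambda>n. dim_col (U n)) [0..<K]) rs.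
       entry G (rs @ drop K is) * entry_prod (map U [0..<K]) (take K is) rs)"
  using assms
\<comment> \<open>The multi-index must vary, since the step evaluates the partial product at
  \<open>is[K := r]\<close>.\<close>
proof (induction K arbitrary: "is")
  case 0
  have "{rs. valid_index [] rs} = {[]}" by (auto simp: valid_index_def)
  then show ?case by (simp add: tucker_def entry_prod_def)
next
  case (Suc K)
  let ?V = "{rs. valid_index (map (\<lambda>n. dim_col (U n)) [0..<K]) rs}"
  have "entry (tucker (Suc K) G U) is =
      (\<Sum>r<dim_col (U K). entry (tucker K G U) (is[K := r]) * U K $$ (is ! K, r))"
    by (simp add: tucker_Suc mode_prod_def)
  also have "\<dots> = (\<Sum>r<dim_col (U K). \<Sum>rs\<in>?V.
      entry G ((rs @ [r]) @ drop (Suc K) is) *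
      entry_prod (map U [0..<Suc K]) (take (Suc K) is) (rs @ [r]))"
  proof (rule sum.cong [OF refl])
    fix r
    \<comment> \<open>The update leaves the first \<open>K\<close> entries alone, so
      \<open>r\<close> passes from the head of the remaining indices to the end of the summation
      index \<open>rs @ [r]\<close>.\<close>
    have d: "drop K (is[K := r]) = r # drop (Suc K) is"
      using Suc.prems by (simp add: drop_update_swap Cons_nth_drop_Suc [symmetric])
    have "entry_prod (map U [0..<Suc K]) (take (Suc K) is) (rs @ [r]) =
        entry_prod (map U [0..<K]) (take K is) rs * U K $$ (is ! K, r)" if "rs \<in> ?V" for rs
    proof -
      have "entry_prod (map U [0..<Suc K]) (take (Suc K) is) (rs @ [r]) =
          entry_prod (map U [0..<K] @ [U K]) (take K is @ [is ! K]) (rs @ [r])"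
        using Suc.prems by (simp add: take_Suc_conv_app_nth)
      also have "\<dots> = entry_prod (map U [0..<K]) (take K is) rs * entry_prod [U K] [is ! K] [r]"
        using that Suc.prems by (intro entry_prod_append) (auto dest: valid_index_length)
      finally show ?thesis by (simp add: entry_prod_def)
    qed
    then show "entry (tucker K G U) (is[K := r]) * U K $$ (is ! K, r) = (\<Sum>rs\<in>?V.
      entry G ((rs @ [r]) @ drop (Suc K) is) *
      entry_prod (map U [0..<Suc K]) (take (Suc K) is) (rs @ [r]))"
      using Suc.prems by (subst Suc.IH) (auto simp: d sum_distrib_right mult.assoc intro!: sum.cong)
  qed
  also have "\<dots> = (\<Sum>rs | valid_index (map (\<lambda>n. dim_col (U n)) [0..<Suc K]) rs.
       entry G (rs @ drop (Suc K) is) * entry_prod (map U [0..<Suc K]) (take (Suc K) is) rs)"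
    by (simp only: sum_valid_index_append1 upt_Suc_append map_append list.map zero_le)
  finally show ?case .
qed

lemma mode_unfold_carrier:
  "mode_unfold n T \<in> carrier_mat (dims T ! n) (prod_list (remove_nth n (dims T)))"
  by (simp add: mode_unfold_def)

lemma index_mult_mult_transpose:
  fixes A :: "'a::comm_semiring_1 mat"
  assumes "A \<in> carrier_mat m p" "B \<in> carrier_mat p q" "C \<in> carrier_mat n q" "i < m" "j < n"
  shows "(A * B * C\<^sup>T) $$ (i, j) = (\<Sum>k<q. (\<Sum>r<p. A $$ (i, r) * B $$ (r, k)) * C $$ (j, k))"
  using assms by (simp add: scalar_prod_def lessThan_atLeast0 del: assoc_mult_mat)

text \<open>In the entry formula for the Tucker tensor, the sum over the index of mode
  \<open>n\<close> is the product of \<open>U n\<close> with the unfolding of \<open>G\<close>. The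
  sum over the other indices, read as a linear column index, is the product with the transposed
  Kronecker matrix.\<close>

lemma mode_unfold_tucker:
  assumes G: "dims G = map (\<lambda>m. dim_col (U m)) [0..<K]" and n: "n < K"
  shows "mode_unfold n (tucker K G U) =
    U n * mode_unfold n G * (kron_list (map U (rev ([0..<n] @ [Suc n..<K]))))\<^sup>T"
proof (rule eq_matI)
  let ?As = "map U ([0..<n] @ [Suc n..<K])" and ?W = "tucker K G U"
  have rev: "map U (rev ([0..<n] @ [Suc n..<K])) = rev ?As" by (simp add: rev_map)
  have As: "remove_nth n (map U [0..<K]) = ?As"
    using n by (simp add: remove_nth_map remove_nth_upt)
  have W: "dims ?W = map dim_row (map U [0..<K])" using G by (simp add: dims_tucker o_def)
  have rW: "remove_nth n (dims ?W) = map dim_row ?As"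
    unfolding W by (simp only: remove_nth_map [of n dim_row] As)
  have G': "dims G = map dim_col (map U [0..<K])" using G by (simp add: o_def)
  have rG: "remove_nth n (dims G) = map dim_col ?As"
    unfolding G' by (simp only: remove_nth_map [of n dim_col] As)
  let ?K = "kron_list (rev ?As)"
  let ?p = "prod_list (map dim_row ?As)" and ?q = "prod_list (map dim_col ?As)"
  have Kc: "?K \<in> carrier_mat ?p ?q"
    by (rule carrier_matI) (simp_all only: dim_kron_list prod_list_map_rev)
  have Gc: "mode_unfold n G \<in> carrier_mat (dim_col (U n)) ?q"
    using mode_unfold_carrier [of n G] n by (simp only: rG) (simp add: G)
  have Wc: "mode_unfold n ?W \<in> carrier_mat (dim_row (U n)) ?p"
    using mode_unfold_carrier [of n ?W] n by (simp only: rW) (simp add: W)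
  have Uc: "U n \<in> carrier_mat (dim_row (U n)) (dim_col (U n))" by auto
  show "dim_row (mode_unfold n ?W) = dim_row (U n * mode_unfold n G * (kron_list (map U (rev ([0..<n] @ [Suc n..<K]))))\<^sup>T)"
    "dim_col (mode_unfold n ?W) = dim_col (U n * mode_unfold n G * (kron_list (map U (rev ([0..<n] @ [Suc n..<K]))))\<^sup>T)"
    unfolding rev using Kc Wc by auto
  fix i j
  assume "i < dim_row (U n * mode_unfold n G * (kron_list (map U (rev ([0..<n] @ [Suc n..<K]))))\<^sup>T)"
    and "j < dim_col (U n * mode_unfold n G * (kron_list (map U (rev ([0..<n] @ [Suc n..<K]))))\<^sup>T)"
  then have i: "i < dim_row (U n)" and j: "j < ?p" unfolding rev using Kc by auto
  \<comment> \<open>The multi-index stored at row \<open>i\<close>, column \<open>j\<close> of the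
    unfolding: \<open>i\<close> in mode \<open>n\<close>, the digits of \<open>j\<close> in the
    other modes.\<close>
  define "is" where "is = insert_nth n i (delin (map dim_row ?As) j)"
  have vj: "valid_index (map dim_row ?As) (delin (map dim_row ?As) j)"
    using j by (rule valid_delin)
  have vis: "valid_index (dims ?W) is"
    unfolding is_def using i n vj by (intro valid_insert_nth) (simp_all only: rW, simp_all add: W)
  then have lis: "length is = K" using W by (simp add: valid_index_length)
  have nl: "n \<le> length (delin (map dim_row ?As) j)"
    using vj n by (auto dest: valid_index_length)
  have isn: "is ! n = i" and ris: "remove_nth n is = delin (map dim_row ?As) j"
    using nl by (simp_all add: is_def remove_insert_nth, simp add: insert_nth_def nth_append)
  have "mode_unfold n ?W $$ (i, j) = entry ?W is"
    using i j n by (simp add: mode_unfold_def rW is_def del: map_append) (simp add: W)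
  also have "\<dots> = (\<Sum>rs | valid_index (dims G) rs. entry G rs * entry_prod (map U [0..<K]) is rs)"
    using lis by (simp add: entry_tucker G)
  also have "\<dots> = (\<Sum>r<dim_col (U n). \<Sum>rs | valid_index (map dim_col ?As) rs.
      entry G (insert_nth n r rs) * entry_prod (map U [0..<K]) is (insert_nth n r rs))"
    using n by (subst sum_valid_index_insert_nth [of n]) (simp_all only: rG, simp_all add: G)
  also have "\<dots> = (\<Sum>r<dim_col (U n). \<Sum>rs | valid_index (map dim_col ?As) rs.
      U n $$ (i, r) * entry G (insert_nth n r rs) * entry_prod ?As (delin (map dim_row ?As) j) rs)"
  proof (intro sum.cong refl)
    fix r rs assume rs: "rs \<in> {rs. valid_index (map dim_col ?As) rs}"
    then have len: "length rs = K - 1" using n by (auto dest!: valid_index_length)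
    then have rn: "insert_nth n r rs ! n = r" "remove_nth n (insert_nth n r rs) = rs"
      "length (insert_nth n r rs) = K"
      using n by (simp add: insert_nth_def nth_append, simp add: remove_insert_nth, simp add: insert_nth_def)
    show "entry G (insert_nth n r rs) * entry_prod (map U [0..<K]) is (insert_nth n r rs) =
        U n $$ (i, r) * entry G (insert_nth n r rs) * entry_prod ?As (delin (map dim_row ?As) j) rs"
      using n lis by (subst entry_prod_remove_nth [of n]) (simp_all only: rn As ris isn, simp_all add: rn mult_ac)
  qed
  also have "\<dots> = (\<Sum>r<dim_col (U n). \<Sum>k<?q.
      U n $$ (i, r) * mode_unfold n G $$ (r, k) * ?K $$ (j, k))"
  proof (intro sum.cong refl)
    fix r assume r: "r \<in> {..<dim_col (U n)}"
    show "(\<Sum>rs | valid_index (map dim_col ?As) rs.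
        U n $$ (i, r) * entry G (insert_nth n r rs) * entry_prod ?As (delin (map dim_row ?As) j) rs) =
      (\<Sum>k<?q. U n $$ (i, r) * mode_unfold n G $$ (r, k) * ?K $$ (j, k))"
      \<comment> \<open>Columns \<open>k\<close> are parametrised as linear positions of
        multi-indices \<open>rs\<close>, so that the two sums can be compared term by term.\<close>
      unfolding sum.reindex_bij_betw [OF bij_betw_lin, symmetric]
    proof (intro sum.cong refl)
      fix rs assume rs: "rs \<in> {rs. valid_index (map dim_col ?As) rs}"
      then have lt: "lin (map dim_col ?As) rs < ?q" and dl: "delin (map dim_col ?As) (lin (map dim_col ?As) rs) = rs"
        by (auto simp: lin_less delin_lin simp del: map_append)
      have "mode_unfold n G $$ (r, lin (map dim_col ?As) rs) = entry G (insert_nth n r rs)"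
        using r n lt G unfolding mode_unfold_def rG by (simp add: dl del: map_append map_map)
      moreover have "?K $$ (j, lin (map dim_col ?As) rs) = entry_prod ?As (delin (map dim_row ?As) j) rs"
        using kron_list_rev_index [OF j lt] unfolding dl .
      ultimately show "U n $$ (i, r) * entry G (insert_nth n r rs) * entry_prod ?As (delin (map dim_row ?As) j) rs =
        U n $$ (i, r) * mode_unfold n G $$ (r, lin (map dim_col ?As) rs) * ?K $$ (j, lin (map dim_col ?As) rs)"
        by simp
    qed
  qed
  also have "\<dots> = (\<Sum>k<?q. (\<Sum>r<dim_col (U n). U n $$ (i, r) * mode_unfold n G $$ (r, k)) * ?K $$ (j, k))"
    by (subst sum.swap) (simp add: sum_distrib_right)
  also have "\<dots> = (U n * mode_unfold n G * ?K\<^sup>T) $$ (i, j)"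
    using index_mult_mult_transpose [OF Uc Gc Kc i j] ..
  finally show "mode_unfold n ?W $$ (i, j) =
      (U n * mode_unfold n G * (kron_list (map U (rev ([0..<n] @ [Suc n..<K]))))\<^sup>T) $$ (i, j)"
    unfolding rev .
qed

section \<open>The chain rule for affine maps\<close>

lemma euclid_norm_nonneg: "euclid_norm v \<ge> 0"
  by (simp add: euclid_norm_def scalar_prod_def sum_nonneg)

lemma euclid_norm_eq_L2_set: "euclid_norm v = L2_set (vec_index v) {..<dim_vec v}"
  by (simp add: euclid_norm_def scalar_prod_def L2_set_def power2_eq_square lessThan_atLeast0)

lemma euclid_norm_mult_mat_vec_bound:
  assumes M: "M \<in> carrier_mat k m"
  obtains C where "C > 0" "\<And>h. h \<in> carrier_vec m \<Longrightarrow> euclid_norm (M *\<^sub>v h) \<le> C * euclid_norm h"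
proof
  \<comment> \<open>The norm of the image is at most the sum of its absolute components, and each
    \<open>\<bar>h $ j\<bar>\<close> is at most the norm of \<open>h\<close>. Adding 1 keeps the
    constant positive even for a zero matrix, so that it can serve as a divisor.\<close>
  let ?C = "\<Sum>i<k. \<Sum>j<m. \<bar>M $$ (i, j)\<bar>"
  show "?C + 1 > 0" by (smt (verit) sum_nonneg abs_ge_zero)
  fix h :: "real vec" assume h: "h \<in> carrier_vec m"
  have "euclid_norm (M *\<^sub>v h) \<le> (\<Sum>i<k. \<bar>(M *\<^sub>v h) $ i\<bar>)"
    using L2_set_le_sum_abs [of "vec_index (M *\<^sub>v h)" "{..<k}"] M by (simp add: euclid_norm_eq_L2_set)
  also have "\<dots> \<le> (\<Sum>i<k. \<Sum>j<m. \<bar>M $$ (i, j)\<bar> * euclid_norm h)"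
  proof (rule sum_mono)
    fix i assume i: "i \<in> {..<k}"
    have "\<bar>(M *\<^sub>v h) $ i\<bar> = \<bar>\<Sum>j<m. M $$ (i, j) * h $ j\<bar>"
      using M h i by (auto simp: scalar_prod_def lessThan_atLeast0 intro!: arg_cong [of _ _ abs] sum.cong)
    also have "\<dots> \<le> (\<Sum>j<m. \<bar>M $$ (i, j)\<bar> * \<bar>h $ j\<bar>)"
      by (rule order_trans [OF sum_abs]) (simp add: abs_mult)
    also have "\<dots> \<le> (\<Sum>j<m. \<bar>M $$ (i, j)\<bar> * euclid_norm h)"
    proof (intro sum_mono mult_left_mono)
      fix j assume "j \<in> {..<m}"
      then have "\<bar>h $ j\<bar> \<le> L2_set (\<lambda>j. \<bar>h $ j\<bar>) {..<m}"
        by (intro member_le_L2_set) auto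
      then show "\<bar>h $ j\<bar> \<le> euclid_norm h"
        using h by (simp add: euclid_norm_eq_L2_set L2_set_def)
    qed simp
    finally show "\<bar>(M *\<^sub>v h) $ i\<bar> \<le> (\<Sum>j<m. \<bar>M $$ (i, j)\<bar> * euclid_norm h)" .
  qed
  also have "\<dots> = ?C * euclid_norm h" by (simp add: sum_distrib_right)
  also have "\<dots> \<le> (?C + 1) * euclid_norm h"
    by (intro mult_right_mono euclid_norm_nonneg) simp
  finally show "euclid_norm (M *\<^sub>v h) \<le> (?C + 1) * euclid_norm h" .
qed

text \<open>The remainder of \<open>f\<close> at \<open>h\<close> is the remainder of
  \<open>L\<close> at the image of \<open>h\<close> under \<open>M\<close>, whose norm is at most
  \<open>C\<close> times that of \<open>h\<close>. Tolerance \<open>e / C\<close> and radius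
  \<open>d / C\<close> absorb this constant, and moving \<open>M\<close> across the scalar product
  yields its transpose.\<close>

lemma has_gradient_affine_comp:
  assumes M: "M \<in> carrier_mat k m" and x: "x \<in> carrier_vec m" and b: "b \<in> carrier_vec k"
    and g: "has_gradient k L (M *\<^sub>v x + b) g"
    and f: "\<And>u. u \<in> carrier_vec m \<Longrightarrow> f u = L (M *\<^sub>v u + b)"
  shows "has_gradient m f x (M\<^sup>T *\<^sub>v g)"
  unfolding has_gradient_def
proof (intro conjI allI impI)
  have gc: "g \<in> carrier_vec k" using g by (simp add: has_gradient_def)
  show "x \<in> carrier_vec m" "M\<^sup>T *\<^sub>v g \<in> carrier_vec m" using M x gc by auto
  fix e :: real assume e: "e > 0"
  obtain C where C: "C > 0" "\<And>h. h \<in> carrier_vec m \<Longrightarrow> euclid_norm (M *\<^sub>v h) \<le> C * euclid_norm h"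
    using euclid_norm_mult_mat_vec_bound [OF M] by blast
  have "e / C > 0" using e C by simp
  then obtain d where d: "d > 0" and D: "\<And>h. h \<in> carrier_vec k \<Longrightarrow> euclid_norm h < d \<Longrightarrow>
      \<bar>L (M *\<^sub>v x + b + h) - L (M *\<^sub>v x + b) - g \<bullet> h\<bar> \<le> e / C * euclid_norm h"
    using g unfolding has_gradient_def by blast
  show "\<exists>d>0. \<forall>h\<in>carrier_vec m. euclid_norm h < d \<longrightarrow>
      \<bar>f (x + h) - f x - (M\<^sup>T *\<^sub>v g) \<bullet> h\<bar> \<le> e * euclid_norm h"
  proof (intro exI [of _ "d / C"] conjI ballI impI)
    show "d / C > 0" using d C by simp
    fix h assume h: "h \<in> carrier_vec m" and hd: "euclid_norm h < d / C"
    have Mh: "M *\<^sub>v h \<in> carrier_vec k" using M h by auto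
    have "C * euclid_norm h < d" using hd C by (simp add: field_simps)
    then have "euclid_norm (M *\<^sub>v h) < d" using C(2) [OF h] by simp
    from D [OF Mh this]
    have "\<bar>L (M *\<^sub>v x + b + M *\<^sub>v h) - L (M *\<^sub>v x + b) - g \<bullet> (M *\<^sub>v h)\<bar> \<le> e / C * euclid_norm (M *\<^sub>v h)" .
    also have "\<dots> \<le> e / C * (C * euclid_norm h)"
      using e C h by (intro mult_left_mono) auto
    also have "\<dots> = e * euclid_norm h" using C by simp
    also have "M *\<^sub>v x + b + M *\<^sub>v h = M *\<^sub>v (x + h) + b"
      using M x b h by (auto simp: mult_add_distrib_mat_vec intro!: eq_vecI)
    also have "g \<bullet> (M *\<^sub>v h) = (M\<^sup>T *\<^sub>v g) \<bullet> h"
      using M gc h by (simp add: transpose_vec_mult_scalar)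
    finally show "\<bar>f (x + h) - f x - (M\<^sup>T *\<^sub>v g) \<bullet> h\<bar> \<le> e * euclid_norm h"
      using f x h by simp
  qed
qed

section \<open>The gradients with respect to factors and core\<close>

theorem mainTheorem1:
  fixes N :: nat and I R :: "nat \<Rightarrow> nat"
    and X G :: "real tensor" and b :: "real vec"
    and U P :: "nat \<Rightarrow> real mat"
    and L :: "real vec \<Rightarrow> real"
  assumes "N \<ge> 1"
    and "dims X = map I [0..<N]"
    and "b \<in> carrier_vec (I N)"
    and "dims G = map R [0..<Suc N]"
    and "\<And>n. n \<le> N \<Longrightarrow> U n \<in> carrier_mat (I n) (R n)"
    and "\<And>y. y \<in> carrier_vec (I N) \<Longrightarrow> \<exists>g. has_gradient (I N) L y g"
    and "\<And>n. n \<le> N \<Longrightarrow> permutation_matrix (prod_list (map I [0..<Suc N])) (P n)"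
    and "\<And>n (T :: real tensor). n \<le> N \<Longrightarrow> dims T = map I [0..<Suc N] \<Longrightarrow>
           vec_mat (mode_unfold N T) = P n *\<^sub>v vec_mat (mode_unfold n T)"
  shows "(\<forall>n\<le>N.
      has_gradient (R n * I n)
        (\<lambda>u. L (layer N X b G (U(n := unvec_mat (I n) (R n) u))))
        (vec_mat (U n))
        ((P n * kron (kron_list (map U (rev ([0..<n] @ [Suc n..<Suc N]))) * (mode_unfold n G)\<^sup>T)
                     (1\<^sub>m (I n)))\<^sup>T
         *\<^sub>v ((kron (mat_of_row (vec_tensor X)) (1\<^sub>m (I N)))\<^sup>T
         *\<^sub>v gradient (I N) L (layer N X b G U)))) \<and>
    has_gradient (prod_list (map R [0..<Suc N]))
      (\<lambda>u. L (layer N X b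
        (mode_refold (map R [0..<Suc N]) N
          (unvec_mat (R N) (prod_list (map R [0..<N])) u)) U))
      (vec_mat (mode_unfold N G))
      ((kron (kron_list (map U (rev [0..<N]))) (U N))\<^sup>T
       *\<^sub>v ((kron (mat_of_row (vec_tensor X)) (1\<^sub>m (I N)))\<^sup>T
       *\<^sub>v gradient (I N) L (layer N X b G U)))"
proof -
  let ?K = "Suc N" and ?Is = "map I [0..<Suc N]" and ?Rs = "map R [0..<Suc N]"
  let ?A = "kron (mat_of_row (vec_tensor X)) (1\<^sub>m (I N))"
  let ?ns = "\<lambda>n. [0..<n] @ [Suc n..<?K]"
  note X = assms(2) and b = assms(3) and G = assms(4) and U = assms(5) and L = assms(6)
    and P = assms(7) and P_vec = assms(8)
  let ?m = "prod_list ?Is"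
  have m: "?m = prod_list (map I [0..<N]) * I N" by simp
  have X_carrier: "vec_tensor X \<in> carrier_vec (prod_list (map I [0..<N]))"
    by (simp add: vec_tensor_def X carrier_vecI)
  have A: "?A \<in> carrier_mat (I N) ?m"
    unfolding m using kron_carrier [of "mat_of_row (vec_tensor X)" 1] X_carrier by fastforce
  have remove: "n \<le> N \<Longrightarrow> remove_nth n (map f [0..<?K]) = map f (?ns n)" for n and f :: "nat \<Rightarrow> nat"
    by (simp only: remove_nth_map remove_nth_upt less_Suc_eq_le)
  have remove_N: "remove_nth N (map f [0..<?K]) = map f [0..<N]" for f :: "nat \<Rightarrow> nat"
    by (simp only: remove) simp
  have size: "n \<le> N \<Longrightarrow> prod_list (map f (?ns n)) * f n = prod_list (map f [0..<?K])"
    for n and f :: "nat \<Rightarrow> nat"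
    using prod_list_remove_nth [of n "map f [0..<?K]"] by (simp only: remove) (simp del: upt_Suc)
  have K: "kron_list (map U (rev ns)) \<in> carrier_mat (prod_list (map I ns)) (prod_list (map R ns))"
    if "set ns \<subseteq> {..N}" for ns
  proof (rule carrier_matI)
    have "map (\<lambda>n. dim_row (U n)) ns = map I ns" "map (\<lambda>n. dim_col (U n)) ns = map R ns"
      using that U by auto
    then show "dim_row (kron_list (map U (rev ns))) = prod_list (map I ns)"
      "dim_col (kron_list (map U (rev ns))) = prod_list (map R ns)"
      by (simp_all only: dim_kron_list map_map prod_list_map_rev o_def)
  qed
  \<comment> \<open>Stated for arbitrary \<open>G'\<close> and \<open>U'\<close> of the right sizes,
    so as to cover both a replaced factor and a refolded core.\<close>
  have dims_W: "dims (tucker ?K G' U') = ?Is" and dims_G': "dims G' = map (\<lambda>n. dim_col (U' n)) [0..<?K]"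
    if "dims G' = ?Rs" "\<And>n. n \<le> N \<Longrightarrow> U' n \<in> carrier_mat (I n) (R n)" for G' U'
  proof -
    have "dim_row (U' n) = I n \<and> dim_col (U' n) = R n" if "n \<le> N" for n
      using \<open>\<And>n. n \<le> N \<Longrightarrow> U' n \<in> carrier_mat (I n) (R n)\<close> [OF that] by auto
    then have "map (\<lambda>n. dim_row (U' n)) [0..<?K] = ?Is" "map (\<lambda>n. dim_col (U' n)) [0..<?K] = ?Rs"
      by (simp_all add: less_Suc_eq_le del: upt_Suc)
    then show "dims (tucker ?K G' U') = ?Is" "dims G' = map (\<lambda>n. dim_col (U' n)) [0..<?K]"
      using that(1) by (simp_all add: dims_tucker del: upt_Suc)
  qed
  have unfold_carrier: "mode_unfold n T \<in> carrier_mat (f n) (prod_list (map f (?ns n)))"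
    if "dims T = map f [0..<?K]" "n \<le> N" for n f and T :: "real tensor"
    using mode_unfold_carrier [of n T] that by (simp only: remove) (simp del: upt_Suc)
  \<comment> \<open>The output is affine in the vectorised mode-\<open>N\<close> unfolding, with the
    same matrix \<open>?A\<close> for every choice of core and factors.\<close>
  have layer_eq: "layer N X b G' U' = ?A *\<^sub>v vec_mat (mode_unfold N (tucker ?K G' U')) + b"
    if "dims G' = ?Rs" "\<And>n. n \<le> N \<Longrightarrow> U' n \<in> carrier_mat (I n) (R n)" for G' U'
  proof -
    have "mode_unfold N (tucker ?K G' U') \<in> carrier_mat (I N) (prod_list (map I [0..<N]))"
      using unfold_carrier [OF dims_W [OF that], of N] by simp
    from mult_mat_vec_eq_kron [OF this X_carrier] show ?thesis by (simp only: layer_def)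
  qed
  have layer_carrier: "layer N X b G U \<in> carrier_vec (I N)"
    using b unfolding layer_def by (intro carrier_vecI) simp
  \<comment> \<open>Differentiability of \<open>L\<close> at the output supplies a gradient, and
    uniqueness identifies it with the description \<open>gradient\<close>.\<close>
  have grad: "has_gradient (I N) L (layer N X b G U) (gradient (I N) L (layer N X b G U))"
    using L [OF layer_carrier] gradient_eqI by metis
  let ?g = "gradient (I N) L (layer N X b G U)"
  have g: "?g \<in> carrier_vec (I N)" using grad by (simp add: has_gradient_def)
  \<comment> \<open>Reduces both claims to finding a matrix \<open>B\<close> through which the
    vectorised mode-\<open>N\<close> unfolding depends linearly on the variable;
    \<open>?A * B\<close> then enters the chain rule, and its transpose splits into the two stated
    factors.\<close>
  have compose: "has_gradient k f x (B\<^sup>T *\<^sub>v (?A\<^sup>T *\<^sub>v ?g))"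
    if B: "B \<in> carrier_mat ?m k" and x: "x \<in> carrier_vec k" and fx: "layer N X b G U = ?A *\<^sub>v (B *\<^sub>v x) + b"
      and f: "\<And>u. u \<in> carrier_vec k \<Longrightarrow> f u = L (?A *\<^sub>v (B *\<^sub>v u) + b)" for k f x B
  proof -
    have "has_gradient k f x ((?A * B)\<^sup>T *\<^sub>v ?g)"
    proof (rule has_gradient_affine_comp)
      show "?A * B \<in> carrier_mat (I N) k" using A B by simp
      show "has_gradient (I N) L (?A * B *\<^sub>v x + b) ?g"
        using grad assoc_mult_mat_vec [OF A B x] by (simp add: fx)
      show "f u = L (?A * B *\<^sub>v u + b)" if "u \<in> carrier_vec k" for u
        using f [OF that] assoc_mult_mat_vec [OF A B that] by simp
    qed fact+
    also have "(?A * B)\<^sup>T *\<^sub>v ?g = B\<^sup>T *\<^sub>v (?A\<^sup>T *\<^sub>v ?g)"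
      using A B g by (simp add: transpose_mult [OF A B] assoc_mult_mat_vec [of _ k ?m _ "I N"])
    finally show ?thesis .
  qed
  show ?thesis
  proof (intro conjI allI impI)
    fix n assume n: "n \<le> N"
    let ?Kn = "kron_list (map U (rev (?ns n)))"
    let ?B = "kron (?Kn * (mode_unfold n G)\<^sup>T) (1\<^sub>m (I n))"
    have Kn: "?Kn \<in> carrier_mat (prod_list (map I (?ns n))) (prod_list (map R (?ns n)))"
      using n by (intro K) auto
    then have KnT: "?Kn\<^sup>T \<in> carrier_mat (prod_list (map R (?ns n))) (prod_list (map I (?ns n)))"
      by (simp only: transpose_carrier_mat)
    have Gn: "mode_unfold n G \<in> carrier_mat (R n) (prod_list (map R (?ns n)))"
      using unfold_carrier [OF G n] .
    have "?B \<in> carrier_mat (prod_list (map I (?ns n)) * I n) (R n * I n)"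
      using Kn Gn by (intro kron_carrier mult_carrier_mat [OF Kn]) auto
    then have B: "?B \<in> carrier_mat ?m (R n * I n)" by (simp only: size [OF n])
    have Pn: "P n \<in> carrier_mat ?m ?m"
      using P [OF n] by (auto simp: permutation_matrix_def)
    have vec_W: "vec_mat (mode_unfold N (tucker ?K G (U(n := V)))) = P n * ?B *\<^sub>v vec_mat V"
      if V: "V \<in> carrier_mat (I n) (R n)" for V
    proof -
      let ?U = "U(n := V)"
      have U': "\<And>k. k \<le> N \<Longrightarrow> ?U k \<in> carrier_mat (I k) (R k)" using U V by simp
      \<comment> \<open>Mode \<open>n\<close> is absent from \<open>?ns n\<close>, so the Kronecker
        matrix stays constant as the factor \<open>V\<close> varies.\<close>
      have unaffected: "map ?U (rev (?ns n)) = map U (rev (?ns n))" by auto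
      have "mode_unfold n (tucker ?K G ?U) = V * mode_unfold n G * ?Kn\<^sup>T"
        using mode_unfold_tucker [OF dims_G' [OF G U'], of n] n
        by (simp only: unaffected less_Suc_eq_le fun_upd_same)
      \<comment> \<open>Regrouping with \<open>V\<close> in the middle fits the vectorisation
        identity; the transpose of the right-hand group is the matrix in the claimed
        formula.\<close>
      also have "\<dots> = 1\<^sub>m (I n) * V * (mode_unfold n G * ?Kn\<^sup>T)"
        by (simp only: left_mult_one_mat [OF V] assoc_mult_mat [OF V Gn KnT])
      finally have "vec_mat (mode_unfold n (tucker ?K G ?U)) =
          kron (mode_unfold n G * ?Kn\<^sup>T)\<^sup>T (1\<^sub>m (I n)) *\<^sub>v vec_mat V"
        by (simp only: vec_mat_mult_kron [OF one_carrier_mat V mult_carrier_mat [OF Gn KnT]])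
      also have "(mode_unfold n G * ?Kn\<^sup>T)\<^sup>T = ?Kn * (mode_unfold n G)\<^sup>T"
        by (simp only: transpose_mult [OF Gn KnT] transpose_transpose)
      finally have "vec_mat (mode_unfold n (tucker ?K G ?U)) = ?B *\<^sub>v vec_mat V" .
      moreover have "vec_mat V \<in> carrier_vec (R n * I n)"
        using V by (auto simp: vec_mat_def mult.commute)
      ultimately show ?thesis
        \<comment> \<open>\<open>P n\<close> carries the mode-\<open>n\<close> vectorisation over to
          the mode-\<open>N\<close> one that \<open>?A\<close> expects.\<close>
        using P_vec [OF n dims_W [OF G U']] assoc_mult_mat_vec [OF Pn B] by (simp only:)
    qed
    show "has_gradient (R n * I n)
        (\<lambda>u. L (layer N X b G (U(n := unvec_mat (I n) (R n) u)))) (vec_mat (U n))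
        ((P n * ?B)\<^sup>T *\<^sub>v (?A\<^sup>T *\<^sub>v ?g))"
    proof (rule compose)
      show "P n * ?B \<in> carrier_mat ?m (R n * I n)" using Pn B by simp
      show "vec_mat (U n) \<in> carrier_vec (R n * I n)"
        using U [OF n] by (auto simp: vec_mat_def mult.commute)
      show "layer N X b G U = ?A *\<^sub>v (P n * ?B *\<^sub>v vec_mat (U n)) + b"
        \<comment> \<open>At the base point \<open>V\<close> is \<open>U n\<close> itself, and
          updating \<open>U\<close> at \<open>n\<close> by its own value changes nothing.\<close>
        using vec_W [OF U [OF n]] by (simp add: layer_eq [OF G U])
      fix u :: "real vec" assume u: "u \<in> carrier_vec (R n * I n)"
      let ?V = "unvec_mat (I n) (R n) u"
      have V: "?V \<in> carrier_mat (I n) (R n)" by (simp add: unvec_mat_def)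
      have "layer N X b G (U(n := ?V)) = ?A *\<^sub>v vec_mat (mode_unfold N (tucker ?K G (U(n := ?V)))) + b"
        using U V by (intro layer_eq G) auto
      then show "L (layer N X b G (U(n := ?V))) = L (?A *\<^sub>v (P n * ?B *\<^sub>v u) + b)"
        using vec_W [OF V] vec_unvec_mat [of u "I n" "R n"] u by (simp add: mult.commute)
    qed
  next
    let ?KN = "kron_list (map U (rev [0..<N]))"
    let ?B = "kron ?KN (U N)" and ?r = "prod_list (map R [0..<N])"
    have KN: "?KN \<in> carrier_mat (prod_list (map I [0..<N])) ?r"
      by (intro K) auto
    have B: "?B \<in> carrier_mat ?m (prod_list ?Rs)"
      using kron_carrier [OF KN U [of N]] by simp
    \<comment> \<open>Now the core unfolding is the middle factor, between \<open>U N\<close> and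
      the transposed Kronecker matrix; for mode \<open>N\<close> the other modes are exactly
      \<open>[0..<N]\<close>.\<close>
    have vec_W: "vec_mat (mode_unfold N (tucker ?K G' U)) = ?B *\<^sub>v vec_mat (mode_unfold N G')"
      if G': "dims G' = ?Rs" for G'
    proof -
      have "mode_unfold N (tucker ?K G' U) = U N * mode_unfold N G' * ?KN\<^sup>T"
        using mode_unfold_tucker [OF dims_G' [OF G' U], of N] by simp
      then have "vec_mat (mode_unfold N (tucker ?K G' U)) = kron ?KN\<^sup>T\<^sup>T (U N) *\<^sub>v vec_mat (mode_unfold N G')"
        using U [of N] KN unfold_carrier [OF G', of N] by (simp only:) (intro vec_mat_mult_kron, auto)
      then show ?thesis by simp
    qed
    show "has_gradient (prod_list ?Rs)
      (\<lambda>u. L (layer N X b (mode_refold ?Rs N (unvec_mat (R N) ?r u)) U))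
      (vec_mat (mode_unfold N G)) (?B\<^sup>T *\<^sub>v (?A\<^sup>T *\<^sub>v ?g))"
    proof (rule compose [OF B])
      show "vec_mat (mode_unfold N G) \<in> carrier_vec (prod_list ?Rs)"
        using unfold_carrier [OF G, of N] by (auto simp: vec_mat_def mult.commute)
      show "layer N X b G U = ?A *\<^sub>v (?B *\<^sub>v vec_mat (mode_unfold N G)) + b"
        by (simp only: layer_eq [OF G U] vec_W [OF G])
      fix u :: "real vec" assume u: "u \<in> carrier_vec (prod_list ?Rs)"
      let ?V = "unvec_mat (R N) ?r u"
      have G': "dims (mode_refold ?Rs N ?V) = ?Rs" by (simp add: mode_refold_def)
      \<comment> \<open>Refolding and then unfolding returns the matrix whose column stacking is
        \<open>u\<close>, so the perturbed layer is linear in \<open>u\<close> up to the shift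
        \<open>b\<close>.\<close>
      have "mode_unfold N (mode_refold ?Rs N ?V) = ?V"
        by (rule mode_unfold_refold) (simp_all add: remove_N unvec_mat_def nth_append del: upt_Suc)
      moreover have "vec_mat ?V = u"
        using u by (intro vec_unvec_mat) (simp add: mult.commute)
      ultimately show "L (layer N X b (mode_refold ?Rs N ?V) U) = L (?A *\<^sub>v (?B *\<^sub>v u) + b)"
        by (simp only: layer_eq [OF G' U] vec_W [OF G'])
    qed
  qed
qed

end
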